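(* Let $n\ge 1$ and $k > n$ be integers, let $\bm{a}_1, \ldots, \bm{a}_k \in \mathbb{R}^n$ (regarded as row vectors), and let $\bm{w} \in (0,+\infty)^k$ be a column vector such that $\|\bm{w}\|_1 = 1$. Then there are an integer $m$ with $\frac{k}{n+1} \le m \le k-n$, column vectors $\bm{w}_1,\ldots,\bm{w}_m \in [0,+\infty)^k$ with $1 \le \|\bm{w}_i\|_0 \le n+1$ and $\|\bm{w}_i\|_1 = 1$ for $i=1,\ldots,m$, and numbers $\varpi_1,\ldots,\varpi_m > 0$ with $\varpi_1 + \cdots + \varpi_m = 1$, such that $$\bm{w} = \varpi_1 \bm{w}_1 + \cdots + \varpi_m \bm{w}_m$$ and $$\bm{w}_i^T \begin{bmatrix} \bm{a}_1 \\ \vdots \\ \bm{a}_k \end{bmatrix} = \bm{w}^T \begin{bmatrix} \bm{a}_1 \\ \vdots \\ \bm{a}_k \end{bmatrix}, \quad i = 1,\ldots,m.$$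
   Context: For a vector $\bm{x} \in \mathbb{R}^k$ with entries $x_1,\ldots,x_k$, $\|\bm{x}\|_0$ is the number of nonzero entries of $\bm{x}$ and $\|\bm{x}\|_1 = \sum_{i=1}^k |x_i|$. The bracket denotes the $k \times n$ matrix whose $s$-th row is $\bm{a}_s$. *)

theory Defs
  imports "HOL-Analysis.Analysis"
begin

definition norm0 :: "real ^ 'k \<Rightarrow> nat"
  where "norm0 x = card {s. x $ s \<noteq> 0}"

definition norm1 :: "real ^ 'k \<Rightarrow> real"
  where "norm1 x = (\<Sum>s\<in>UNIV. \<bar>x $ s\<bar>)"

end

theory Submission
  imports Defs
begin

text \<open>
  Read \<open>w\<close> as the weights of a convex combination of the rows of a matrix \<open>A\<close>, with barycentre
  \<open>w v* A\<close>.  By Caratheodory's theorem the same barycentre is already attained by weights \<open>v\<close>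
  supported on at most \<open>n + 1\<close> of the rows that \<open>w\<close> uses (\<open>sparse_prob_vec\<close>).  Subtract from
  \<open>w\<close> the largest multiple \<open>t *\<^sub>R v\<close> that leaves a nonnegative vector.  Some entry becomes zero, and
  after division by \<open>1 - t\<close> the remainder is again a probability vector with the same barycentre
  and a strictly smaller support (\<open>peel_off_sparse\<close>).

  Iterating until the support has at most \<open>n + 1\<close> elements takes at most \<open>k - n - 1\<close> steps, and
  the last remainder supplies one more term, so \<open>m \<le> k - n\<close> (\<open>sparse_decomposition\<close>).  The
  lower bound on \<open>m\<close> holds for every decomposition: \<open>m\<close> supports of size at most \<open>n + 1\<close> must
  cover all \<open>k\<close> indices.
\<close>

definition prob_vec :: "real ^ 'k \<Rightarrow> bool"
  where "prob_vec x \<longleftrightarrow> (\<forall>s. 0 \<le> x $ s) \<and> norm1 x = 1"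

lemma prob_vec_iff: "prob_vec x \<longleftrightarrow> (\<forall>s. 0 \<le> x $ s) \<and> (\<Sum>s\<in>UNIV. x $ s) = 1"
  by (auto simp: prob_vec_def norm1_def)

lemma norm0_ge_1_if_prob_vec:
  assumes "prob_vec x"
  shows "1 \<le> norm0 x"
proof -
  have "{s. x $ s \<noteq> 0} \<noteq> {}"
    using assms by (force simp: prob_vec_iff)
  then show ?thesis
    by (simp add: norm0_def Suc_le_eq card_gt_0_iff)
qed

lemma vector_matrix_mult_eq_sum_rows:
  fixes x :: "real ^ 'k" and A :: "real ^ 'n ^ 'k::finite"
  shows "x v* A = (\<Sum>s\<in>UNIV. x $ s *\<^sub>R A $ s)"
  by (simp add: vec_eq_iff vector_matrix_mult_def mult.commute)

text \<open>
  Caratheodory's theorem selects few points, whereas a bound on the support of the weights asks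
  for few indices.  Since rows may coincide, each selected point is traced back to a single
  index, and that index receives the whole weight of the point.
\<close>

lemma sparse_prob_vec:
  fixes w :: "real ^ 'k" and A :: "real ^ 'n::finite ^ 'k::finite"
  assumes w: "prob_vec w"
  obtains v where "prob_vec v" "norm0 v \<le> CARD('n) + 1" "\<And>s. w $ s = 0 \<Longrightarrow> v $ s = 0"
    "v v* A = w v* A"
proof -
  define P where "P = {s. w $ s \<noteq> 0}"
  have sum_P: "(\<Sum>s\<in>P. w $ s) = 1"
  proof -
    have "(\<Sum>s\<in>P. w $ s) = (\<Sum>s\<in>UNIV. w $ s)"
      by (rule sum.mono_neutral_left) (auto simp: P_def)
    then show ?thesis
      using w by (simp add: prob_vec_iff)
  qed
  have "w v* A = (\<Sum>s\<in>P. w $ s *\<^sub>R A $ s)"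
    unfolding vector_matrix_mult_eq_sum_rows
    by (rule sum.mono_neutral_right) (auto simp: P_def)
  also have "\<dots> \<in> convex hull ((\<lambda>s. A $ s) ` P)"
    using w sum_P by (intro convex_sum) (auto simp: prob_vec_iff hull_inc)
  finally obtain S u where S: "finite S" "S \<subseteq> (\<lambda>s. A $ s) ` P" "card S \<le> CARD('n) + 1"
    and u: "\<forall>x\<in>S. 0 \<le> u x" "sum u S = 1" "(\<Sum>x\<in>S. u x *\<^sub>R x) = w v* A"
    unfolding convex_hull_caratheodory by auto
  obtain I where I: "I \<subseteq> P" "inj_on (\<lambda>s. A $ s) I" "S = (\<lambda>s. A $ s) ` I"
    using S(2) by (meson subset_image_inj)
  define v where "v = (\<chi> s. if s \<in> I then u (A $ s) else 0)"
  have v_sum: "(\<Sum>s\<in>UNIV. v $ s) = 1"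
  proof -
    have "(\<Sum>s\<in>UNIV. v $ s) = (\<Sum>s\<in>I. u (A $ s))"
      by (simp add: v_def flip: sum.inter_filter)
    then show ?thesis
      using u(2) I by (simp add: sum.reindex)
  qed
  show ?thesis
  proof
    show "prob_vec v"
      using u(1) I(3) v_sum by (auto simp: prob_vec_iff v_def)
    have "norm0 v \<le> card I"
      unfolding norm0_def by (rule card_mono) (auto simp: v_def)
    also have "card I = card S"
      using I by (simp add: card_image)
    finally show "norm0 v \<le> CARD('n) + 1"
      using S(3) by simp
    show "v $ s = 0" if "w $ s = 0" for s
      using that I(1) by (auto simp: v_def P_def)
    have "v v* A = (\<Sum>s\<in>I. u (A $ s) *\<^sub>R A $ s)"
      unfolding vector_matrix_mult_eq_sum_rows
      by (rule sum.mono_neutral_cong_right) (auto simp: v_def)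
    also have "\<dots> = w v* A"
      using u(3) I by (simp add: sum.reindex)
    finally show "v v* A = w v* A" .
  qed
qed

text \<open>
  The maximal multiple is \<open>t = w\<^sub>s / v\<^sub>s\<close>, minimised over the support of \<open>v\<close>.  It is below \<open>1\<close>
  because the remainder \<open>w - t *\<^sub>R v\<close> has mass \<open>1 - t\<close> and is nonzero: \<open>w\<close> has more than
  \<open>n + 1\<close> nonzero entries and \<open>v\<close> has not.
\<close>

lemma peel_off_sparse:
  fixes w :: "real ^ 'k" and A :: "real ^ 'n::finite ^ 'k::finite"
  assumes w: "prob_vec w" and many: "CARD('n) + 1 < norm0 w"
  obtains t v w' where "0 < t" "t < 1" "w = t *\<^sub>R v + (1 - t) *\<^sub>R w'"
    "prob_vec v" "norm0 v \<le> CARD('n) + 1" "v v* A = w v* A"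
    "prob_vec w'" "norm0 w' < norm0 w" "w' v* A = w v* A"
proof -
  obtain v where v: "prob_vec v" "norm0 v \<le> CARD('n) + 1" "\<And>s. w $ s = 0 \<Longrightarrow> v $ s = 0"
    "v v* A = w v* A"
    using sparse_prob_vec[OF w, of A] by blast
  define Q where "Q = {s. v $ s \<noteq> 0}"
  define t where "t = Min ((\<lambda>s. w $ s / v $ s) ` Q)"
  have "Q \<noteq> {}"
    using norm0_ge_1_if_prob_vec[OF v(1)] by (metis Q_def card.empty norm0_def not_one_le_zero)
  then have "t \<in> (\<lambda>s. w $ s / v $ s) ` Q"
    unfolding t_def by (intro Min_in) auto
  then obtain s0 where s0: "v $ s0 \<noteq> 0" "t = w $ s0 / v $ s0"
    by (auto simp: Q_def)
  have w_nonneg: "0 \<le> w $ s" and v_nonneg: "0 \<le> v $ s" for s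
    using w v(1) by (auto simp: prob_vec_iff)
  have s0_pos: "0 < v $ s0" "0 < w $ s0"
    using s0(1) v(3)[of s0] w_nonneg[of s0] v_nonneg[of s0] by force+
  have t_pos: "0 < t"
    using s0_pos by (simp add: s0(2))
  have le: "t * v $ s \<le> w $ s" for s
  proof (cases "v $ s = 0")
    case True
    then show ?thesis
      using w_nonneg by simp
  next
    case False
    then have "t \<le> w $ s / v $ s"
      unfolding t_def by (intro Min_le) (auto simp: Q_def)
    then show ?thesis
      using False v_nonneg[of s] by (simp add: field_simps)
  qed
  define r where "r = w - t *\<^sub>R v"
  have r_nonneg: "0 \<le> r $ s" for s
    using le by (simp add: r_def)
  have r_sum: "(\<Sum>s\<in>UNIV. r $ s) = 1 - t"
    using w v(1) by (simp add: r_def prob_vec_iff sum_subtractf flip: sum_distrib_left)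
  have t_less: "t < 1"
  proof (rule ccontr)
    assume "\<not> t < 1"
    then have "(\<Sum>s\<in>UNIV. r $ s) = 0"
      using r_sum sum_nonneg[of UNIV "\<lambda>s. r $ s"] r_nonneg by fastforce
    then have "w = t *\<^sub>R v"
      using r_nonneg by (simp add: sum_nonneg_eq_0_iff vec_eq_iff r_def)
    then have "norm0 w \<le> norm0 v"
      unfolding norm0_def by (intro card_mono) auto
    then show False
      using v(2) many by simp
  qed
  define w' where "w' = (1 / (1 - t)) *\<^sub>R r"
  have eq: "(1 - t) *\<^sub>R w' = w - t *\<^sub>R v"
    using t_less by (simp add: w'_def r_def)
  show ?thesis
  proof
    show "0 < t" "t < 1" "prob_vec v" "norm0 v \<le> CARD('n) + 1" "v v* A = w v* A"
      by (fact t_pos t_less v)+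
    show "w = t *\<^sub>R v + (1 - t) *\<^sub>R w'"
      by (simp add: eq)
    show "prob_vec w'"
      using r_nonneg r_sum t_less by (simp add: prob_vec_iff w'_def flip: sum_divide_distrib)
    have "{s. w' $ s \<noteq> 0} \<subseteq> {s. w $ s \<noteq> 0} - {s0}"
      using v(3) s0 by (auto simp: w'_def r_def)
    then show "norm0 w' < norm0 w"
      unfolding norm0_def using s0_pos(2) by (intro psubset_card_mono) auto
    have "(1 - t) *\<^sub>R (w' v* A) = (w - t *\<^sub>R v) v* A"
      by (simp add: vector_matrix_mult_eq_sum_rows scaleR_sum_right flip: eq)
    also have "\<dots> = w v* A - t *\<^sub>R (v v* A)"
      by (simp add: vector_matrix_mult_eq_sum_rows scaleR_diff_left sum_subtractf scaleR_sum_right)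
    also have "\<dots> = (1 - t) *\<^sub>R (w v* A)"
      by (simp add: v(4) scaleR_diff_left)
    finally show "w' v* A = w v* A"
      using t_less by simp
  qed
qed

text \<open>
  The bound is \<open>max 1 \<dots>\<close> because a vector that is already sparse still needs one term,
  namely itself, even when its support has at most \<open>n\<close> elements.
\<close>

lemma sparse_decomposition:
  fixes w :: "real ^ 'k" and A :: "real ^ 'n::finite ^ 'k::finite"
  assumes "prob_vec w"
  shows "\<exists>(m::nat) v \<omega>. m \<le> max 1 (norm0 w - CARD('n)) \<and>
    (\<forall>i\<in>{1..m}. prob_vec (v i) \<and> norm0 (v i) \<le> CARD('n) + 1 \<and> v i v* A = w v* A) \<and>
    (\<forall>i\<in>{1..m}. \<omega> i > (0::real)) \<and> (\<Sum>i=1..m. \<omega> i) = 1 \<and> w = (\<Sum>i=1..m. \<omega> i *\<^sub>R v i)"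
  using assms
proof (induction "norm0 w" arbitrary: w rule: less_induct)
  case less
  show ?case
  proof (cases "norm0 w \<le> CARD('n) + 1")
    case True
    then show ?thesis
      using less.prems by (intro exI[of _ 1] exI[of _ "\<lambda>_. w"] exI[of _ "\<lambda>_. 1"]) auto
  next
    case False
    then obtain t u w' where t: "0 < t" "t < 1" and w: "w = t *\<^sub>R u + (1 - t) *\<^sub>R w'"
      and u: "prob_vec u" "norm0 u \<le> CARD('n) + 1" "u v* A = w v* A"
      and w': "prob_vec w'" "norm0 w' < norm0 w" "w' v* A = w v* A"
      using peel_off_sparse[OF less.prems, of A] by (metis not_le)
    obtain m v \<omega> where m: "m \<le> max 1 (norm0 w' - CARD('n))"
      and v: "\<forall>i\<in>{1..m}. prob_vec (v i) \<and> norm0 (v i) \<le> CARD('n) + 1 \<and> v i v* A = w' v* A"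
      and \<omega>: "\<forall>i\<in>{1..m}. \<omega> i > 0" "(\<Sum>i=1..m. \<omega> i) = 1"
      and w'_eq: "w' = (\<Sum>i=1..m. \<omega> i *\<^sub>R v i)"
      using less.hyps[OF w'(2,1)] by blast
    define v' where "v' = v(Suc m := u)"
    define \<omega>' where "\<omega>' = (\<lambda>i. (1 - t) * \<omega> i)(Suc m := t)"
    have "(\<Sum>i=1..m. \<omega>' i) = (\<Sum>i=1..m. (1 - t) * \<omega> i)"
      by (rule sum.cong) (auto simp: \<omega>'_def)
    then have sum': "(\<Sum>i=1..Suc m. \<omega>' i) = 1"
      using \<omega>(2) by (simp add: \<omega>'_def flip: sum_distrib_left)
    have "(\<Sum>i=1..m. \<omega>' i *\<^sub>R v' i) = (\<Sum>i=1..m. (1 - t) *\<^sub>R \<omega> i *\<^sub>R v i)"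
      by (rule sum.cong) (auto simp: \<omega>'_def v'_def)
    also have "\<dots> = (1 - t) *\<^sub>R w'"
      by (simp only: w'_eq scaleR_sum_right)
    finally have w_eq: "w = (\<Sum>i=1..Suc m. \<omega>' i *\<^sub>R v' i)"
      using w by (simp add: \<omega>'_def v'_def)
    have bound: "Suc m \<le> max 1 (norm0 w - CARD('n))"
      using m w'(2) False by auto
    have "\<forall>i\<in>{1..Suc m}. prob_vec (v' i) \<and> norm0 (v' i) \<le> CARD('n) + 1 \<and> v' i v* A = w v* A"
      using v u w'(3) by (auto simp: v'_def)
    moreover have "\<forall>i\<in>{1..Suc m}. \<omega>' i > 0"
      using \<omega>(1) t by (auto simp: \<omega>'_def)
    ultimately show ?thesis
      using bound sum' w_eq by blast
  qed
qed

lemma norm0_sum_scaleR_le: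
  fixes v :: "'i \<Rightarrow> real ^ 'k::finite"
  assumes "finite I"
  shows "norm0 (\<Sum>i\<in>I. c i *\<^sub>R v i) \<le> (\<Sum>i\<in>I. norm0 (v i))"
proof -
  have "norm0 (\<Sum>i\<in>I. c i *\<^sub>R v i) \<le> card (\<Union>i\<in>I. {s. v i $ s \<noteq> 0})"
    unfolding norm0_def
  proof (rule card_mono)
    show "{s. (\<Sum>i\<in>I. c i *\<^sub>R v i) $ s \<noteq> 0} \<subseteq> (\<Union>i\<in>I. {s. v i $ s \<noteq> 0})"
      by (auto intro: sum.neutral)
  qed simp
  also have "\<dots> \<le> (\<Sum>i\<in>I. norm0 (v i))"
    unfolding norm0_def by (rule card_UN_le[OF assms])
  finally show ?thesis .
qed

theorem theorem12p6:
  fixes a :: "'k::finite \<Rightarrow> real ^ 'n::finite"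
    and w :: "real ^ 'k"
  assumes "CARD('k) > CARD('n)"
    and "\<And>s. w $ s > 0"
    and "norm1 w = 1"
  shows "\<exists>(m::nat) (v :: nat \<Rightarrow> real ^ 'k) (\<omega> :: nat \<Rightarrow> real).
           real CARD('k) / (real CARD('n) + 1) \<le> real m \<and>
           m \<le> CARD('k) - CARD('n) \<and>
           (\<forall>i\<in>{1..m}. (\<forall>s. v i $ s \<ge> 0) \<and>
              1 \<le> norm0 (v i) \<and> norm0 (v i) \<le> CARD('n) + 1 \<and> norm1 (v i) = 1) \<and>
           (\<forall>i\<in>{1..m}. \<omega> i > 0) \<and>
           (\<Sum>i=1..m. \<omega> i) = 1 \<and>
           w = (\<Sum>i=1..m. \<omega> i *\<^sub>R v i) \<and>
           (\<forall>i\<in>{1..m}. v i v* (\<chi> s. a s) = w v* (\<chi> s. a s))"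
proof -
  have "prob_vec w"
    using assms(2,3) by (auto simp: prob_vec_def intro: less_imp_le)
  then obtain m v \<omega> where m: "m \<le> max 1 (norm0 w - CARD('n))"
    and v: "\<forall>i\<in>{1..m}. prob_vec (v i) \<and> norm0 (v i) \<le> CARD('n) + 1 \<and>
      v i v* (\<chi> s. a s) = w v* (\<chi> s. a s)"
    and \<omega>: "\<forall>i\<in>{1..m}. \<omega> i > (0::real)" "(\<Sum>i=1..m. \<omega> i) = 1"
    and w: "w = (\<Sum>i=1..m. \<omega> i *\<^sub>R v i)"
    using sparse_decomposition[of w "\<chi> s. a s"] by blast
  have k: "norm0 w = CARD('k)"
    using assms(2) by (simp add: norm0_def less_imp_neq[symmetric])
  have upper: "m \<le> CARD('k) - CARD('n)"
    using m assms(1) by (simp add: k)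
  have "norm0 w \<le> (\<Sum>i=1..m. norm0 (v i))"
    by (subst w) (rule norm0_sum_scaleR_le, simp)
  also have "\<dots> \<le> (\<Sum>i=1..m. CARD('n) + 1)"
    using v by (intro sum_mono) auto
  finally have "CARD('k) \<le> m * (CARD('n) + 1)"
    by (simp add: k)
  then have "real CARD('k) \<le> real m * (real CARD('n) + 1)"
    by (metis of_nat_1 of_nat_add of_nat_le_iff of_nat_mult)
  then have lower: "real CARD('k) / (real CARD('n) + 1) \<le> real m"
    by (simp add: divide_le_eq)
  show ?thesis
  proof (intro exI conjI)
    show "\<forall>i\<in>{1..m}. (\<forall>s. v i $ s \<ge> 0) \<and>
        1 \<le> norm0 (v i) \<and> norm0 (v i) \<le> CARD('n) + 1 \<and> norm1 (v i) = 1"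
      using v norm0_ge_1_if_prob_vec unfolding prob_vec_def by blast
    show "\<forall>i\<in>{1..m}. v i v* (\<chi> s. a s) = w v* (\<chi> s. a s)"
      using v by blast
  qed (fact lower upper \<omega> w)+
qed

end
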